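(* Let $\mathcal{R}$ be an associative ring with unit $1\neq 0$, let $a,x\in\mathcal{R}$ and let $\mathcal{S},\mathcal{T}$ be right ideals of $\mathcal{R}$. Then the following assertions are equivalent: (1) $x=a^{(1,2)}_{{\rm rprin}=\mathcal{S},{\rm rann}=\mathcal{T}}$, i.e. $x\in a\{1,2\}$, $x\mathcal{R}=\mathcal{S}$ and ${\rm rann}(x)=\mathcal{T}$. (2) $\varphi_{ax}=\rho_{a\mathcal{R},\mathcal{T}}$, $\varphi_{xa}=\rho_{\mathcal{S},\,{\rm rann}(a)}$, and $x\in\mathcal{S}$. (3) $\varphi_{ax}=\rho_{a\mathcal{R},\mathcal{T}}$, $\varphi_{xa}=\rho_{\mathcal{S},\,{\rm rann}(a)}$, and ${\rm lann}(\mathcal{S})\subseteq{\rm lann}(x)$. (4) $\varphi_{ax}=\rho_{a\mathcal{R},\mathcal{T}}$, $\varphi_{xa}=\rho_{\mathcal{S},\,{\rm rann}(a)}$, and $\mathcal{T}\subseteq{\rm rann}(x)$. (5) $x\in a\{1\}$, $xa\mathcal{R}=\mathcal{S}$, ${\rm rann}(ax)=\mathcal{T}$, and $x\in\mathcal{S}$. (6) $x\in a\{1\}$, $xa\mathcal{R}=\mathcal{S}$, ${\rm rann}(ax)=\mathcal{T}$, and ${\rm lann}(\mathcal{S})\subseteq{\rm lann}(x)$. (7) $x\in a\{1\}$, $xa\mathcal{R}=\mathcal{S}$, ${\rm rann}(ax)=\mathcal{T}$, and $\mathcal{T}\subseteq{\rm rann}(x)$. (8) $x=\rho_{\mathcal{S},\,{\rm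 rann}(a)}(1)\,a^{(1)}\,\rho_{a\mathcal{R},\mathcal{T}}(1)$ for some $a^{(1)}\in a\{1\}$.
   Context: Notation: $a\{1\}=\{x\in\mathcal{R}:axa=a\}$, $a\{1,2\}=\{x\in\mathcal{R}:axa=a,\ xax=x\}$; $a\mathcal{R}=\{ar:r\in\mathcal{R}\}$, ${\rm rann}(a)=\{r\in\mathcal{R}:ar=0\}$, ${\rm lann}(a)=\{r\in\mathcal{R}:ra=0\}$, and for $\mathcal{A}\subseteq\mathcal{R}$, ${\rm lann}(\mathcal{A})=\{r\in\mathcal{R}:ra=0\ \forall a\in\mathcal{A}\}$. $\varphi_a:\mathcal{R}\to\mathcal{R}$ is the additive group endomorphism $\varphi_a(r)=ar$. For additive subgroups $\mathcal{S},\mathcal{T}$ of $\mathcal{R}$, $\mathcal{R}=\mathcal{S}\oplus\mathcal{T}$ means $\mathcal{R}=\mathcal{S}+\mathcal{T}$ and $\mathcal{S}\cap\mathcal{T}=\{0\}$; in that case $\rho_{\mathcal{S},\mathcal{T}}:\mathcal{R}\to\mathcal{R}$ is the group endomorphism $\rho_{\mathcal{S},\mathcal{T}}(s+t)=s$ for $s\in\mathcal{S}$, $t\in\mathcal{T}$. Convention: whenever $\rho_{\mathcal{S},\mathcal{T}}$ is written, it is implicitly asserted that $\mathcal{R}=\mathcal{S}\oplus\mathcal{T}$; thus (2), (3), (4) and (8) each include the assertions $\mathcal{R}=a\mathcal{R}\oplus\mathcal{T}$ and $\mathcal{R}=\mathcal{S}\oplus{\rm rann}(a)$. *)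

theory Defs imports Main
begin

definition inner_inverses :: "'a::ring_1 \<Rightarrow> 'a set" where
  "inner_inverses a = {x. a * x * a = a}"

definition reflexive_inverses :: "'a::ring_1 \<Rightarrow> 'a set" where
  "reflexive_inverses a = {x. a * x * a = a \<and> x * a * x = x}"

definition rprin :: "'a::ring_1 \<Rightarrow> 'a set" where
  "rprin a = {a * r | r. True}"

definition rann :: "'a::ring_1 \<Rightarrow> 'a set" where
  "rann a = {r. a * r = 0}"

definition lann :: "'a::ring_1 \<Rightarrow> 'a set" where
  "lann a = {r. r * a = 0}"

definition lann_set :: "'a::ring_1 set \<Rightarrow> 'a set" where
  "lann_set A = {r. \<forall>a\<in>A. r * a = 0}"

definition additive_subgroup :: "'a::ring_1 set \<Rightarrow> bool" where
  "additive_subgroup S \<longleftrightarrow>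
     0 \<in> S \<and> (\<forall>s\<in>S. \<forall>t\<in>S. s + t \<in> S) \<and> (\<forall>s\<in>S. - s \<in> S)"

definition right_ideal :: "'a::ring_1 set \<Rightarrow> bool" where
  "right_ideal S \<longleftrightarrow> additive_subgroup S \<and> (\<forall>s\<in>S. \<forall>r. s * r \<in> S)"

definition left_mult :: "'a::ring_1 \<Rightarrow> 'a \<Rightarrow> 'a" where
  "left_mult a = (\<lambda>r. a * r)"

definition direct_sum :: "'a::ring_1 set \<Rightarrow> 'a set \<Rightarrow> bool" where
  "direct_sum S T \<longleftrightarrow> UNIV = {s + t | s t. s \<in> S \<and> t \<in> T} \<and> S \<inter> T = {0}"

text \<open>Meaningful only when \<open>direct_sum S T\<close> holds for additive subgroups \<open>S\<close>, \<open>T\<close>;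
  assertions about it must state \<open>direct_sum S T\<close> explicitly.\<close>

definition proj :: "'a::ring_1 set \<Rightarrow> 'a set \<Rightarrow> 'a \<Rightarrow> 'a" where
  "proj S T r = (THE s. s \<in> S \<and> (\<exists>t\<in>T. r = s + t))"

text \<open>Writing the projection onto \<open>S\<close> along \<open>T\<close> implicitly asserts that the ring is the
  direct sum of \<open>S\<close> and \<open>T\<close>; the first conjunct makes this explicit.\<close>

definition is_proj :: "('a::ring_1 \<Rightarrow> 'a) \<Rightarrow> 'a set \<Rightarrow> 'a set \<Rightarrow> bool" where
  "is_proj f S T \<longleftrightarrow> direct_sum S T \<and> f = proj S T"

text \<open>A relation rather than a function of \<open>a\<close>, \<open>S\<close>, \<open>T\<close>, since such an inverse
  need not exist.\<close>

definition is_inverse12_rprin_rann ::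
  "'a::ring_1 \<Rightarrow> 'a set \<Rightarrow> 'a set \<Rightarrow> 'a \<Rightarrow> bool" where
  "is_inverse12_rprin_rann a S T x \<longleftrightarrow>
     x \<in> reflexive_inverses a \<and> rprin x = S \<and> rann x = T"

definition all_equivalent :: "bool list \<Rightarrow> bool" where
  "all_equivalent Ps \<longleftrightarrow> (\<forall>P\<in>set Ps. \<forall>Q\<in>set Ps. P \<longleftrightarrow> Q)"

end

theory Submission imports Defs
begin

text \<open>
  The eight assertions are statements about the two elements \<open>a * x\<close> and \<open>x * a\<close>. A left
  multiplication \<open>\<phi>\<^sub>e\<close> is the projection onto \<open>S\<close> along \<open>T\<close> exactly when \<open>e\<close> is an idempotent
  with \<open>e\<R> = S\<close> and \<open>rann e = T\<close> (lemma \<open>is_proj_left_mult_iff\<close>), because an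
  idempotent yields the Peirce decomposition \<open>r = e r + (1 - e) r\<close>. If \<open>a x a = a\<close>, both
  products are idempotent, \<open>a x\<R> = a\<R>\<close> and \<open>rann (x a) = rann a\<close>; so the two projection
  conditions say no more than \<open>a x a = a\<close>, \<open>x a\<R> = S\<close> and \<open>rann (a x) = T\<close> (lemma
  \<open>projection_conditions_iff\<close>).

  What these conditions leave open is whether \<open>x a x = x\<close>. This equation says
  that the idempotent \<open>x a\<close> fixes \<open>x\<close> from the left, equivalently that the idempotent \<open>a x\<close>
  fixes \<open>x\<close> from the right. The clauses \<open>x \<in> S\<close> and \<open>lann S \<subseteq> lann x\<close> express
  the former, the clause \<open>T \<subseteq> rann x\<close> the latter. Hence everything reduces to one normal
  form: \<open>a x a = a\<close>, \<open>x a x = x\<close>, \<open>x a\<R> = S\<close>, \<open>rann (a x) = T\<close>.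

  For the product formula, let \<open>p\<close> and \<open>q\<close> be the images of \<open>1\<close> under the two projections.
  Projections along right ideals are right linear, so they are \<open>\<phi>\<^sub>p\<close> and \<open>\<phi>\<^sub>q\<close>. If \<open>x = p y q\<close>
  with \<open>a y a = a\<close>, then the choice of \<open>y\<close> disappears from \<open>x a = p\<close> and \<open>a x = q\<close>
  (lemma \<open>inner_inverse_between_projections\<close>); conversely a reflexive inverse satisfies
  \<open>x = (x a) x (a x)\<close>.
\<close>

section \<open>Right ideals and direct sums\<close>

lemma additive_subgroup_diff:
  assumes "additive_subgroup S" "s \<in> S" "t \<in> S"
  shows "s - t \<in> S"
proof -
  have "s + - t \<in> S" using assms unfolding additive_subgroup_def by blast
  then show ?thesis by simp
qed

lemma right_ideal_rprin: "right_ideal (rprin (a :: 'a::ring_1))"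
proof -
  have "0 \<in> rprin a" unfolding rprin_def by (auto intro: exI[of _ 0])
  moreover have "s + t \<in> rprin a" if "s \<in> rprin a" "t \<in> rprin a" for s t
    using that unfolding rprin_def by (auto simp: distrib_left[symmetric])
  moreover have "- s \<in> rprin a" if s: "s \<in> rprin a" for s
  proof -
    obtain r where "s = a * r" using s unfolding rprin_def by blast
    then have "- s = a * - r" by simp
    then show ?thesis unfolding rprin_def by blast
  qed
  moreover have "s * r \<in> rprin a" if "s \<in> rprin a" for s r
    using that unfolding rprin_def by (auto simp: mult.assoc)
  ultimately show ?thesis unfolding right_ideal_def additive_subgroup_def by blast
qed

lemma right_ideal_rann: "right_ideal (rann (a :: 'a::ring_1))"
  unfolding right_ideal_def additive_subgroup_def rann_def
  by (auto simp: distrib_left mult.assoc[symmetric])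

lemma generator_in_rprin: "a \<in> rprin (a :: 'a::ring_1)"
  unfolding rprin_def by (auto intro: exI[of _ 1])

lemma proj_eqI:
  assumes "additive_subgroup S" "additive_subgroup T" "direct_sum S T"
    and "s \<in> S" "t \<in> T" "r = s + t"
  shows "proj S T r = s"
  unfolding proj_def
proof (rule the_equality)
  show "s \<in> S \<and> (\<exists>t\<in>T. r = s + t)" using assms by blast
next
  fix s' assume "s' \<in> S \<and> (\<exists>t\<in>T. r = s' + t)"
  then obtain t' where s': "s' \<in> S" and t': "t' \<in> T" "r = s' + t'" by blast
  have "s' - s \<in> S" using assms s' by (blast intro: additive_subgroup_diff)
  moreover have "t - t' \<in> T" using assms t' by (blast intro: additive_subgroup_diff)
  moreover have "s' - s = t - t'" using t'(2) assms(6) by (simp add: algebra_simps)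
  ultimately have "s' - s \<in> S \<inter> T" by simp
  then show "s' = s" using assms(3) unfolding direct_sum_def by simp
qed

lemma direct_sumE:
  assumes "direct_sum S T"
  obtains s t where "s \<in> S" "t \<in> T" "r = s + t"
  using assms unfolding direct_sum_def by blast

section \<open>Idempotents and projections\<close>

lemma idempotent_rprin_iff:
  fixes e :: "'a::ring_1"
  assumes "e * e = e"
  shows "r \<in> rprin e \<longleftrightarrow> e * r = r"
proof
  assume "r \<in> rprin e"
  then show "e * r = r" using assms unfolding rprin_def by (auto simp: mult.assoc[symmetric])
next
  assume "e * r = r"
  then show "r \<in> rprin e" unfolding rprin_def by (auto intro: exI[of _ r])
qed

text \<open>The element \<open>1 - e\<close> annihilates \<open>e\<R>\<close> from the left, so the inclusion makes it annihilate
  \<open>x\<close>; in the other direction \<open>x\<close> itself lies in \<open>e\<R>\<close>.\<close>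

lemma idempotent_lann_subset_iff:
  fixes e :: "'a::ring_1"
  assumes "e * e = e"
  shows "lann_set (rprin e) \<subseteq> lann x \<longleftrightarrow> e * x = x"
proof
  assume *: "lann_set (rprin e) \<subseteq> lann x"
  have "1 - e \<in> lann_set (rprin e)"
    unfolding lann_set_def by (auto simp: idempotent_rprin_iff[OF assms] algebra_simps)
  then have "1 - e \<in> lann x" using * by blast
  then show "e * x = x" unfolding lann_def by (simp add: left_diff_distrib)
next
  assume "e * x = x"
  then have "x \<in> rprin e" using assms by (simp add: idempotent_rprin_iff)
  then show "lann_set (rprin e) \<subseteq> lann x" unfolding lann_set_def lann_def by blast
qed

text \<open>The element \<open>1 - e\<close> lies in \<open>rann e\<close>; conversely \<open>x = x e\<close> factors \<open>\<phi>\<^sub>x\<close> through \<open>\<phi>\<^sub>e\<close>.\<close>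

lemma idempotent_rann_subset_iff:
  fixes e :: "'a::ring_1"
  assumes "e * e = e"
  shows "rann e \<subseteq> rann x \<longleftrightarrow> x * e = x"
proof
  assume *: "rann e \<subseteq> rann x"
  have "1 - e \<in> rann e" using assms unfolding rann_def by (simp add: algebra_simps)
  then have "1 - e \<in> rann x" using * by blast
  then show "x * e = x" unfolding rann_def by (simp add: right_diff_distrib)
next
  assume xe: "x * e = x"
  have "x * t = 0" if "e * t = 0" for t
  proof -
    have "x * t = x * (e * t)" using xe by (simp add: mult.assoc[symmetric])
    then show ?thesis using that by simp
  qed
  then show "rann e \<subseteq> rann x" unfolding rann_def by blast
qed

lemma idempotent_direct_sum:
  fixes e :: "'a::ring_1"
  assumes "e * e = e"
  shows "direct_sum (rprin e) (rann e)"
proof -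
  have "\<exists>s t. r = s + t \<and> s \<in> rprin e \<and> t \<in> rann e" for r
  proof (intro exI conjI)
    show "r = e * r + (r - e * r)" by simp
    show "e * r \<in> rprin e" unfolding rprin_def by blast
    show "r - e * r \<in> rann e"
      using assms unfolding rann_def by (simp add: right_diff_distrib mult.assoc[symmetric])
  qed
  moreover have "rprin e \<inter> rann e = {0}"
    by (auto simp: idempotent_rprin_iff[OF assms] rann_def)
  ultimately show ?thesis unfolding direct_sum_def by blast
qed

lemma is_proj_left_mult_iff:
  fixes e :: "'a::ring_1"
  assumes S: "additive_subgroup S" and T: "additive_subgroup T"
  shows "is_proj (left_mult e) S T \<longleftrightarrow> e * e = e \<and> rprin e = S \<and> rann e = T"
proof
  assume "is_proj (left_mult e) S T"
  then have ds: "direct_sum S T" and e: "\<And>r. e * r = proj S T r"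
    unfolding is_proj_def left_mult_def by metis+
  have zero: "0 \<in> S" "0 \<in> T" using S T unfolding additive_subgroup_def by auto
  have fixS: "e * s = s" if "s \<in> S" for s
    using proj_eqI[OF S T ds that zero(2)] e by simp
  have killT: "e * t = 0" if "t \<in> T" for t
    using proj_eqI[OF S T ds zero(1) that] e by simp
  have img: "e * r \<in> S" for r
  proof -
    obtain s t where "s \<in> S" "t \<in> T" "r = s + t" using direct_sumE[OF ds] by blast
    then show ?thesis using fixS killT by (simp add: distrib_left)
  qed
  have "e * e = e" using fixS[OF img[of 1]] by simp
  moreover have "rprin e = S"
  proof
    show "rprin e \<subseteq> S" using img unfolding rprin_def by blast
    show "S \<subseteq> rprin e"
    proof
      fix s assume "s \<in> S"
      then have "s = e * s" using fixS by simp
      then show "s \<in> rprin e" unfolding rprin_def by blast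
    qed
  qed
  moreover have "rann e = T"
  proof
    show "T \<subseteq> rann e" using killT unfolding rann_def by blast
    show "rann e \<subseteq> T"
    proof
      fix r assume "r \<in> rann e"
      then have "e * r = 0" unfolding rann_def by simp
      moreover obtain s t where "s \<in> S" "t \<in> T" "r = s + t" using direct_sumE[OF ds] by blast
      ultimately show "r \<in> T" using fixS killT by (simp add: distrib_left)
    qed
  qed
  ultimately show "e * e = e \<and> rprin e = S \<and> rann e = T" by blast
next
  assume *: "e * e = e \<and> rprin e = S \<and> rann e = T"
  then have ds: "direct_sum S T" using idempotent_direct_sum by blast
  have "e * r = proj S T r" for r
  proof (rule proj_eqI[OF S T ds, symmetric])
    show "e * r \<in> S" using * unfolding rprin_def by blast
    show "r - e * r \<in> T"
      using * unfolding rann_def by (auto simp: right_diff_distrib mult.assoc[symmetric])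
    show "r = e * r + (r - e * r)" by simp
  qed
  then show "is_proj (left_mult e) S T" using ds unfolding is_proj_def left_mult_def by blast
qed

text \<open>Multiplying \<open>1 = p + t\<close> by \<open>r\<close> on the right decomposes \<open>r\<close>, since both summands absorb
  right multiples. The image of \<open>1\<close> therefore determines the projection.\<close>

lemma is_proj_left_mult_proj_one:
  fixes S T :: "'a::ring_1 set"
  assumes S: "right_ideal S" and T: "right_ideal T" and ds: "direct_sum S T"
  shows "is_proj (left_mult (proj S T 1)) S T"
proof -
  have S': "additive_subgroup S" and T': "additive_subgroup T"
    using S T unfolding right_ideal_def by auto
  obtain p t where pt: "p \<in> S" "t \<in> T" "1 = p + t" using direct_sumE[OF ds] by blast
  have "p * r = proj S T r" for r
  proof (rule proj_eqI[OF S' T' ds, symmetric])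
    show "p * r \<in> S" "t * r \<in> T" using S T pt unfolding right_ideal_def by auto
    show "r = p * r + t * r" using pt(3) by (metis distrib_right mult_1)
  qed
  moreover have "proj S T 1 = p" using proj_eqI[OF S' T' ds pt] .
  ultimately show ?thesis using ds unfolding is_proj_def left_mult_def by auto
qed

section \<open>Inner inverses with prescribed range and annihilator\<close>

lemma inner_inverse_idempotents:
  fixes a x :: "'a::ring_1"
  assumes "a * x * a = a"
  shows "a * x * (a * x) = a * x" "x * a * (x * a) = x * a"
  using assms by (simp_all add: mult.assoc) (simp add: mult.assoc[symmetric])

lemma inner_inverse_rprin:
  fixes a x :: "'a::ring_1"
  assumes "a * x * a = a"
  shows "rprin (a * x) = rprin a"
proof
  show "rprin (a * x) \<subseteq> rprin a" unfolding rprin_def by (auto simp: mult.assoc)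
  have "a * r = a * x * (a * r)" for r using assms by (simp add: mult.assoc[symmetric])
  then show "rprin a \<subseteq> rprin (a * x)" unfolding rprin_def by blast
qed

lemma inner_inverse_rann:
  fixes a x :: "'a::ring_1"
  assumes "a * x * a = a"
  shows "rann (x * a) = rann a"
proof
  show "rann a \<subseteq> rann (x * a)" unfolding rann_def by (auto simp: mult.assoc)
  have "a * r = 0" if "x * a * r = 0" for r
  proof -
    have "a * r = a * (x * a * r)" using assms by (simp add: mult.assoc[symmetric])
    then show ?thesis using that by simp
  qed
  then show "rann (x * a) \<subseteq> rann a" unfolding rann_def by blast
qed

lemma projection_conditions_iff:
  fixes a x :: "'a::ring_1"
  assumes S: "additive_subgroup S" and T: "additive_subgroup T"
  shows "is_proj (left_mult (a * x)) (rprin a) T \<and> is_proj (left_mult (x * a)) S (rann a) \<longleftrightarrow>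
    x \<in> inner_inverses a \<and> rprin (x * a) = S \<and> rann (a * x) = T"
proof -
  have R: "additive_subgroup (rprin a)" and N: "additive_subgroup (rann a)"
    using right_ideal_rprin right_ideal_rann unfolding right_ideal_def by auto
  show ?thesis
  proof
    assume *: "is_proj (left_mult (a * x)) (rprin a) T \<and> is_proj (left_mult (x * a)) S (rann a)"
    have ax: "a * x * (a * x) = a * x" "rprin (a * x) = rprin a" "rann (a * x) = T"
      using iffD1[OF is_proj_left_mult_iff[OF R T] conjunct1[OF *]] by simp_all
    have xa: "rprin (x * a) = S"
      using iffD1[OF is_proj_left_mult_iff[OF S N] conjunct2[OF *]] by simp
    \<comment> \<open>The idempotent \<open>a x\<close> fixes its range \<open>a\<R>\<close>, in particular \<open>a\<close>.\<close>
    have "a \<in> rprin (a * x)" unfolding ax(2) by (rule generator_in_rprin)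
    then have "a * x * a = a" by (rule iffD1[OF idempotent_rprin_iff[OF ax(1)]])
    then show "x \<in> inner_inverses a \<and> rprin (x * a) = S \<and> rann (a * x) = T"
      unfolding inner_inverses_def using ax(3) xa by simp
  next
    assume *: "x \<in> inner_inverses a \<and> rprin (x * a) = S \<and> rann (a * x) = T"
    then have axa: "a * x * a = a" unfolding inner_inverses_def by simp
    show "is_proj (left_mult (a * x)) (rprin a) T \<and> is_proj (left_mult (x * a)) S (rann a)"
      unfolding is_proj_left_mult_iff[OF R T] is_proj_left_mult_iff[OF S N]
      by (intro conjI inner_inverse_idempotents[OF axa] inner_inverse_rprin[OF axa]
        inner_inverse_rann[OF axa] conjunct1[OF conjunct2[OF *]] conjunct2[OF conjunct2[OF *]])
  qed
qed

text \<open>An outer inverse \<open>x\<close> has the range of \<open>x a\<close> and the annihilator of \<open>a x\<close>: this is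
  the behaviour of an inner inverse with the two elements exchanged.\<close>

lemma is_inverse12_rprin_rann_iff:
  fixes a x :: "'a::ring_1"
  shows "is_inverse12_rprin_rann a S T x \<longleftrightarrow>
    (x \<in> inner_inverses a \<and> rprin (x * a) = S \<and> rann (a * x) = T) \<and> x * a * x = x"
proof -
  have "rprin (x * a) = rprin x \<and> rann (a * x) = rann x" if "x * a * x = x"
    using inner_inverse_rprin[OF that] inner_inverse_rann[OF that] by blast
  then show ?thesis
    unfolding is_inverse12_rprin_rann_def reflexive_inverses_def inner_inverses_def by auto
qed

text \<open>The idempotents \<open>p\<close> and \<open>y a\<close> have the same right annihilator \<open>rann a\<close>, which contains
  \<open>1 - p\<close> and \<open>1 - y a\<close>; hence \<open>a p = a\<close> and \<open>p y a = p\<close>. The idempotents \<open>q\<close> and \<open>a y\<close>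
  have the same range \<open>a\<R>\<close>, which contains \<open>a\<close> and \<open>q\<close>; hence \<open>q a = a\<close> and \<open>a y q = q\<close>.\<close>

lemma inner_inverse_between_projections:
  fixes a y p q :: "'a::ring_1"
  assumes y: "a * y * a = a"
    and p: "p * p = p" "rann p = rann a"
    and q: "q * q = q" "rprin q = rprin a"
  shows "p * y * q * a = p" "a * (p * y * q) = q"
proof -
  note ya = inner_inverse_idempotents(2)[OF y] and ay = inner_inverse_idempotents(1)[OF y]
  have "a \<in> rprin q" unfolding q(2) by (rule generator_in_rprin)
  then have qa: "q * a = a" by (rule iffD1[OF idempotent_rprin_iff[OF q(1)]])
  have "rann p \<subseteq> rann a" unfolding p(2) by (rule subset_refl)
  then have ap: "a * p = a" by (rule iffD1[OF idempotent_rann_subset_iff[OF p(1)]])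
  have "rann (y * a) \<subseteq> rann p" unfolding p(2) inner_inverse_rann[OF y] by (rule subset_refl)
  then have pya: "p * (y * a) = p" by (rule iffD1[OF idempotent_rann_subset_iff[OF ya]])
  have "q \<in> rprin (a * y)"
    unfolding inner_inverse_rprin[OF y] q(2)[symmetric] by (rule generator_in_rprin)
  then have ayq: "a * y * q = q" by (rule iffD1[OF idempotent_rprin_iff[OF ay]])
  have "p * y * q * a = p * (y * (q * a))" by (simp only: mult.assoc)
  then show "p * y * q * a = p" by (simp only: qa pya)
  have "a * (p * y * q) = a * p * y * q" by (simp only: mult.assoc)
  then show "a * (p * y * q) = q" by (simp only: ap ayq)
qed

lemma product_formula_iff:
  fixes a x :: "'a::ring_1"
  assumes S: "right_ideal S" and T: "right_ideal T"
  shows "(direct_sum S (rann a) \<and> direct_sum (rprin a) T \<and>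
      (\<exists>y\<in>inner_inverses a. x = proj S (rann a) 1 * y * proj (rprin a) T 1)) \<longleftrightarrow>
    (x \<in> inner_inverses a \<and> rprin (x * a) = S \<and> rann (a * x) = T) \<and> x * a * x = x"
    (is "?product \<longleftrightarrow> ?core \<and> ?outer")
proof
  have S': "additive_subgroup S" and T': "additive_subgroup T"
    using S T unfolding right_ideal_def by auto
  {
    assume ?product
    then obtain y where dS: "direct_sum S (rann a)" and dT: "direct_sum (rprin a) T"
      and y: "a * y * a = a" and x: "x = proj S (rann a) 1 * y * proj (rprin a) T 1"
      unfolding inner_inverses_def by blast
    define p where "p = proj S (rann a) 1"
    define q where "q = proj (rprin a) T 1"
    have P: "is_proj (left_mult p) S (rann a)"
      unfolding p_def by (rule is_proj_left_mult_proj_one[OF S right_ideal_rann dS])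
    have Q: "is_proj (left_mult q) (rprin a) T"
      unfolding q_def by (rule is_proj_left_mult_proj_one[OF right_ideal_rprin T dT])
    have p: "p * p = p" "rann p = rann a"
      using P is_proj_left_mult_iff[OF S'] right_ideal_rann unfolding right_ideal_def by blast+
    have q: "q * q = q" "rprin q = rprin a"
      using Q is_proj_left_mult_iff[OF _ T'] right_ideal_rprin unfolding right_ideal_def by blast+
    have xp: "x * a = p" and xq: "a * x = q"
      using inner_inverse_between_projections[OF y p q] unfolding x p_def q_def by auto
    have ?core
      using P Q projection_conditions_iff[OF S' T', of a x] unfolding xp xq by blast
    moreover have "p * x = x"
      unfolding x p_def[symmetric] using p(1) by (simp add: mult.assoc[symmetric])
    ultimately show "?core \<and> ?outer" unfolding xp by blast
  }
  {
    assume co: "?core \<and> ?outer"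
    then have "is_proj (left_mult (a * x)) (rprin a) T" "is_proj (left_mult (x * a)) S (rann a)"
      using projection_conditions_iff[OF S' T', of a x] by blast+
    then have ds: "direct_sum (rprin a) T" "direct_sum S (rann a)"
      and "left_mult (a * x) 1 = proj (rprin a) T 1" "left_mult (x * a) 1 = proj S (rann a) 1"
      unfolding is_proj_def by auto
    then have one: "proj (rprin a) T 1 = a * x" "proj S (rann a) 1 = x * a"
      unfolding left_mult_def by auto
    \<comment> \<open>The inner inverse \<open>x\<close> itself serves as \<open>y\<close>.\<close>
    have "x = x * a * x * (a * x)" using co by (simp add: mult.assoc[symmetric])
    then show ?product using ds co unfolding one by blast
  }
qed

section \<open>The equivalence of the characterizations\<close>

theorem theorem6p1:
  fixes a x :: "'a::ring_1" and S T :: "'a set"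
  assumes "right_ideal S" and "right_ideal T"
  shows "all_equivalent
    [is_inverse12_rprin_rann a S T x,
     is_proj (left_mult (a * x)) (rprin a) T \<and>
       is_proj (left_mult (x * a)) S (rann a) \<and> x \<in> S,
     is_proj (left_mult (a * x)) (rprin a) T \<and>
       is_proj (left_mult (x * a)) S (rann a) \<and> lann_set S \<subseteq> lann x,
     is_proj (left_mult (a * x)) (rprin a) T \<and>
       is_proj (left_mult (x * a)) S (rann a) \<and> T \<subseteq> rann x,
     x \<in> inner_inverses a \<and> rprin (x * a) = S \<and> rann (a * x) = T \<and> x \<in> S,
     x \<in> inner_inverses a \<and> rprin (x * a) = S \<and> rann (a * x) = T \<and> lann_set S \<subseteq> lann x,
     x \<in> inner_inverses a \<and> rprin (x * a) = S \<and> rann (a * x) = T \<and> T \<subseteq> rann x,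
     direct_sum S (rann a) \<and> direct_sum (rprin a) T \<and>
       (\<exists>y\<in>inner_inverses a. x = proj S (rann a) 1 * y * proj (rprin a) T 1)]"
  (is "all_equivalent ?list")
proof -
  let ?core = "x \<in> inner_inverses a \<and> rprin (x * a) = S \<and> rann (a * x) = T"
  let ?outer = "x * a * x = x"
  let ?projections = "is_proj (left_mult (a * x)) (rprin a) T \<and>
    is_proj (left_mult (x * a)) S (rann a)"
  have projections: "?projections \<longleftrightarrow> ?core"
    using assms projection_conditions_iff unfolding right_ideal_def by blast
  have member: "x \<in> S \<longleftrightarrow> ?outer" and lann: "lann_set S \<subseteq> lann x \<longleftrightarrow> ?outer"
    and rann: "T \<subseteq> rann x \<longleftrightarrow> ?outer" if core: ?core
  proof -
    have "a * x * a = a" using core unfolding inner_inverses_def by blast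
    note idem = inner_inverse_idempotents[OF this]
    show "x \<in> S \<longleftrightarrow> ?outer" using core idempotent_rprin_iff[OF idem(2)] by blast
    show "lann_set S \<subseteq> lann x \<longleftrightarrow> ?outer"
      using core idempotent_lann_subset_iff[OF idem(2)] by blast
    show "T \<subseteq> rann x \<longleftrightarrow> ?outer"
      using core idempotent_rann_subset_iff[OF idem(1), of x] by (simp add: mult.assoc)
  qed
  have "\<forall>P\<in>set ?list. P \<longleftrightarrow> ?core \<and> ?outer"
    unfolding list.set ball_simps
  proof (intro conjI TrueI)
    show "is_inverse12_rprin_rann a S T x \<longleftrightarrow> ?core \<and> ?outer"
      by (rule is_inverse12_rprin_rann_iff)
  next
    show "is_proj (left_mult (a * x)) (rprin a) T \<and>
       is_proj (left_mult (x * a)) S (rann a) \<and> x \<in> S \<longleftrightarrow> ?core \<and> ?outer"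
      using projections member by blast
  next
    show "is_proj (left_mult (a * x)) (rprin a) T \<and>
       is_proj (left_mult (x * a)) S (rann a) \<and> lann_set S \<subseteq> lann x \<longleftrightarrow> ?core \<and> ?outer"
      using projections lann by blast
  next
    show "is_proj (left_mult (a * x)) (rprin a) T \<and>
       is_proj (left_mult (x * a)) S (rann a) \<and> T \<subseteq> rann x \<longleftrightarrow> ?core \<and> ?outer"
      using projections rann by blast
  next
    show "x \<in> inner_inverses a \<and> rprin (x * a) = S \<and> rann (a * x) = T \<and> x \<in> S
      \<longleftrightarrow> ?core \<and> ?outer"
      using member by blast
  next
    show "x \<in> inner_inverses a \<and> rprin (x * a) = S \<and> rann (a * x) = T \<and> lann_set S \<subseteq> lann x
      \<longleftrightarrow> ?core \<and> ?outer"
      using lann by blast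
  next
    show "x \<in> inner_inverses a \<and> rprin (x * a) = S \<and> rann (a * x) = T \<and> T \<subseteq> rann x
      \<longleftrightarrow> ?core \<and> ?outer"
      using rann by blast
  qed (rule product_formula_iff[OF assms])
  then show ?thesis unfolding all_equivalent_def by blast
qed

end
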